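(* Let $r\ge 0$. Then $\varphi_1$ is a critical point of $\tilde E_r$ such that (i) $\varphi_1$ is a global minimum of $\tilde E_r$ on $\mathcal{P}$, and (ii) $\tilde E_r(\varphi_1)=\lambda_1^L-r$. Thus $(\lambda_1^L,\lambda_1^L-r)\in\Sigma_L$, a point lying on the vertical line through $(\lambda_1^L,\lambda_1^L)$.
   Context: Let $N\ge 1$ be an integer and let $\Omega\subset\mathbb{R}^N$ be a bounded domain (open and connected) with $C^{1,1}$ boundary. $\|\cdot\|_2$ is the $L^2(\Omega)$ norm; $u^\pm=\max\{\pm u,0\}$, so $u=u^+-u^-$. Put $c_N=\pi^{-N/2}\Gamma(N/2)$ and $\rho_N=2\ln 2+\psi(N/2)-\gamma$, with $\psi=\Gamma'/\Gamma$ the digamma function and $\gamma=-\Gamma'(1)$; $B_1$ is the unit ball centred at $0$, $k(z)=\mathbf 1_{B_1}(z)|z|^{-N}$, $j(z)=\mathbf 1_{\mathbb{R}^N\setminus B_1}(z)|z|^{-N}$ for $z\neq 0$. $\mathbb{H}(\Omega)$ is the Hilbert space of all $u\in L^2(\Omega)$, extended by $u=0$ in $\mathbb{R}^N\setminus\Omega$, with $\iint_{\mathbb{R}^{2N}}|u(x)-u(y)|^2k(x-y)\,dx\,dy<\infty$, with inner product $\mathcal{E}(u,v)=\frac{c_N}{2}\iint_{\mathbb{R}^{2N}}(u(x)-u(y))(v(x)-v(y))k(x-y)\,dx\,dy$ and norm $\|u\|=\mathcal{E}(u,u)^{1/2}$. The quadratic form of the logarithmic Laplacian $L_\Delta$ (the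 operator with Fourier symbol $2\ln|\xi|$) is $$\mathcal{E}_L(u,v)=\mathcal{E}(u,v)-c_N\iint_{\mathbb{R}^{2N}}u(x)v(y)j(x-y)\,dx\,dy+\rho_N\int_{\mathbb{R}^N}uv\,dx .$$ The Fučík spectrum $\Sigma_L$ is the set of $(\alpha,\beta)\in\mathbb{R}^2$ for which there is a nontrivial $u\in\mathbb{H}(\Omega)$ with $\mathcal{E}_L(u,v)=\int_\Omega(\alpha u^+-\beta u^-)v\,dx$ for all $v\in\mathbb{H}(\Omega)$ (i.e. a nontrivial weak solution of $L_\Delta u=\alpha u^+-\beta u^-$ in $\Omega$, $u=0$ in $\mathbb{R}^N\setminus\Omega$). The first eigenvalue is $\lambda_1^L=\min\{\mathcal{E}_L(u,u):u\in\mathbb{H}(\Omega),\|u\|_2=1\}$; it is simple, and $\varphi_1>0$ denotes the associated eigenfunction with $\|\varphi_1\|_2=1$. Let $\mathcal{P}=\{u\in\mathbb{H}(\Omega): I(u)=1\}$, $I(u)=\int_\Omega u^2\,dx$, $E_r(u)=\mathcal{E}_L(u,u)-r\int_\Omega(u^+)^2\,dx$, and $\tilde E_r=E_r|_{\mathcal{P}}$. A point $u\in\mathcal{P}$ is a critical point of $\tilde E_r$ if there is $t\in\mathbb{R}$ with $E_r'(u)=tI'(u)$, i.e. $\mathcal{E}_L(u,v)-r\int_\Omega u^+v\,dx=t\int_\Omega uv\,dx$ for all $v\in\mathbb{H}(\Omega)$. *)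

theory Defs
  imports "HOL-Analysis.Analysis"
begin

subsection \<open>Bounded domains with boundary of class \<open>C\<^sup>1\<^sup>,\<^sup>1\<close>\<close>

definition C11_function :: "('a::euclidean_space \<Rightarrow> real) \<Rightarrow> bool" where
  "C11_function g \<longleftrightarrow>
     (\<exists>g'. (\<forall>x. GDERIV g x :> g' x) \<and> (\<exists>L. L-lipschitz_on UNIV g'))"

text \<open>
  Near each boundary point, \<open>\<Omega>\<close> is the region above a \<open>C\<^sup>1\<^sup>,\<^sup>1\<close> graph in some direction \<open>\<nu>\<close>.
  The graph function is evaluated only at \<open>x - (x \<bullet> \<nu>) \<nu>\<close>, the orthogonal projection of \<open>x\<close> to
  the hyperplane \<open>\<nu>\<^sup>\<bottom>\<close>, so it is a function of \<open>N - 1\<close> variables. For \<open>N = 1\<close> it is a constant.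
\<close>

definition C11_boundary :: "'a::euclidean_space set \<Rightarrow> bool" where
  "C11_boundary \<Omega> \<longleftrightarrow>
     (\<forall>p\<in>frontier \<Omega>. \<exists>\<nu> s g. norm \<nu> = 1 \<and> s > 0 \<and> C11_function g \<and>
        \<Omega> \<inter> ball p s = {x \<in> ball p s. x \<bullet> \<nu> > g (x - (x \<bullet> \<nu>) *\<^sub>R \<nu>)})"


subsection \<open>Constants and kernels\<close>

text \<open>
  The dimension is \<open>N = DIM('a)\<close>; it enters the constants through an argument of type
  \<^typ>\<open>nat\<close>. The next two facts confirm that the library's \<^const>\<open>Polygamma\<close> at \<open>0\<close> is
  \<open>\<Gamma>' / \<Gamma>\<close> and that its Euler-Mascheroni constant is \<open>- \<Gamma>'(1)\<close>.
\<close>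

lemma Digamma_eq_deriv_Gamma:
  assumes "(x::real) > 0"
  shows "Digamma x = deriv Gamma x / Gamma x"
proof -
  have "x \<notin> \<int>\<^sub>\<le>\<^sub>0" using assms by (auto elim!: nonpos_Ints_cases)
  then have "deriv Gamma x = Gamma x * Digamma x" "Gamma x \<noteq> 0"
    by (auto intro!: DERIV_imp_deriv has_field_derivative_Gamma simp: Gamma_eq_zero_iff)
  then show ?thesis by simp
qed

lemma euler_mascheroni_eq_deriv_Gamma: "euler_mascheroni = - deriv Gamma (1::real)"
  using Digamma_eq_deriv_Gamma[of 1] by simp

definition c_const :: "nat \<Rightarrow> real" where
  "c_const N = pi powr (- real N / 2) * Gamma (real N / 2)"

definition rho_const :: "nat \<Rightarrow> real" where
  "rho_const N = 2 * ln 2 + Digamma (real N / 2) - euler_mascheroni"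

definition k_kernel :: "'a::euclidean_space \<Rightarrow> real" where
  "k_kernel z = indicat_real (ball 0 1) z / norm z ^ DIM('a)"

definition j_kernel :: "'a::euclidean_space \<Rightarrow> real" where
  "j_kernel z = indicat_real (- ball 0 1) z / norm z ^ DIM('a)"


subsection \<open>The space \<open>\<bbbH>(\<Omega>)\<close> and the quadratic form of the logarithmic Laplacian\<close>

text \<open>
  Elements of \<open>L\<^sup>2(\<Omega>)\<close> are represented by Borel functions vanishing outside \<open>\<Omega>\<close>; every
  Lebesgue class has such a representative, and all notions below are invariant under
  changes on null sets. Equality of elements of \<open>\<bbbH>(\<Omega>)\<close> is therefore equality almost everywhere.
\<close>

definition H_space :: "'a::euclidean_space set \<Rightarrow> ('a \<Rightarrow> real) set" where
  "H_space \<Omega> = {u \<in> borel_measurable lborel.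
     (\<forall>x. x \<notin> \<Omega> \<longrightarrow> u x = 0) \<and>
     set_integrable lborel \<Omega> (\<lambda>x. (u x)\<^sup>2) \<and>
     (\<integral>\<^sup>+ (x, y). ennreal (\<bar>u x - u y\<bar>\<^sup>2 * k_kernel (x - y)) \<partial>(lborel \<Otimes>\<^sub>M lborel)) < \<infinity>}"

definition E_form :: "('a::euclidean_space \<Rightarrow> real) \<Rightarrow> ('a \<Rightarrow> real) \<Rightarrow> real" where
  "E_form u v = c_const DIM('a) / 2 *
     (LINT (x, y)|(lborel \<Otimes>\<^sub>M lborel). (u x - u y) * (v x - v y) * k_kernel (x - y))"

definition E_L :: "('a::euclidean_space \<Rightarrow> real) \<Rightarrow> ('a \<Rightarrow> real) \<Rightarrow> real" where
  "E_L u v = E_form u v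
     - c_const DIM('a) * (LINT (x, y)|(lborel \<Otimes>\<^sub>M lborel). u x * v y * j_kernel (x - y))
     + rho_const DIM('a) * (LINT x|lborel. u x * v x)"

definition L2_norm :: "'a::euclidean_space set \<Rightarrow> ('a \<Rightarrow> real) \<Rightarrow> real" where
  "L2_norm \<Omega> u = sqrt (LINT x:\<Omega>|lborel. (u x)\<^sup>2)"

definition pos_part :: "('a \<Rightarrow> real) \<Rightarrow> 'a \<Rightarrow> real" where
  "pos_part u x = max (u x) 0"

definition neg_part :: "('a \<Rightarrow> real) \<Rightarrow> 'a \<Rightarrow> real" where
  "neg_part u x = max (- u x) 0"


subsection \<open>The Fucik spectrum and the first eigenvalue\<close>

definition Fucik_spectrum :: "'a::euclidean_space set \<Rightarrow> (real \<times> real) set" where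
  "Fucik_spectrum \<Omega> = {(\<alpha>, \<beta>). \<exists>u\<in>H_space \<Omega>. \<not> (AE x in lborel. u x = 0) \<and>
     (\<forall>v\<in>H_space \<Omega>. E_L u v =
        (LINT x:\<Omega>|lborel. (\<alpha> * pos_part u x - \<beta> * neg_part u x) * v x))}"

text \<open>
  The minimum is written as an infimum; it is attained as soon as there is a function satisfying
  \<open>is_first_eigenfunction\<close> below.
\<close>

definition first_eigenvalue :: "'a::euclidean_space set \<Rightarrow> real" where
  "first_eigenvalue \<Omega> = Inf {E_L u u |u. u \<in> H_space \<Omega> \<and> L2_norm \<Omega> u = 1}"

definition is_first_eigenfunction :: "'a::euclidean_space set \<Rightarrow> ('a \<Rightarrow> real) \<Rightarrow> bool" where
  "is_first_eigenfunction \<Omega> \<phi> \<longleftrightarrow>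
     \<phi> \<in> H_space \<Omega> \<and> L2_norm \<Omega> \<phi> = 1 \<and>
     (AE x in lborel. x \<in> \<Omega> \<longrightarrow> \<phi> x > 0) \<and>
     (\<forall>v\<in>H_space \<Omega>. E_L \<phi> v = first_eigenvalue \<Omega> * (LINT x:\<Omega>|lborel. \<phi> x * v x))"


subsection \<open>The constrained functional\<close>

definition I_fun :: "'a::euclidean_space set \<Rightarrow> ('a \<Rightarrow> real) \<Rightarrow> real" where
  "I_fun \<Omega> u = (LINT x:\<Omega>|lborel. (u x)\<^sup>2)"

definition P_set :: "'a::euclidean_space set \<Rightarrow> ('a \<Rightarrow> real) set" where
  "P_set \<Omega> = {u \<in> H_space \<Omega>. I_fun \<Omega> u = 1}"

definition E_fun :: "'a::euclidean_space set \<Rightarrow> real \<Rightarrow> ('a \<Rightarrow> real) \<Rightarrow> real" where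
  "E_fun \<Omega> r u = E_L u u - r * (LINT x:\<Omega>|lborel. (pos_part u x)\<^sup>2)"

text \<open>
  Critical points of \<open>E_fun \<Omega> r\<close> restricted to \<open>P_set \<Omega>\<close>: \<open>E\<^sub>r'(u) = t I'(u)\<close>, in weak form
  and divided by the common factor \<open>2\<close>.
\<close>

definition is_critical_point :: "'a::euclidean_space set \<Rightarrow> real \<Rightarrow> ('a \<Rightarrow> real) \<Rightarrow> bool" where
  "is_critical_point \<Omega> r u \<longleftrightarrow> u \<in> P_set \<Omega> \<and>
     (\<exists>t. \<forall>v\<in>H_space \<Omega>.
        E_L u v - r * (LINT x:\<Omega>|lborel. pos_part u x * v x) = t * (LINT x:\<Omega>|lborel. u x * v x))"

end

theory Submission
  imports Defs
begin

text \<open>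
  On \<open>P_set \<Omega>\<close> the quadratic form \<^const>\<open>E_L\<close> is bounded below
  (\<open>E_L_bounded_below\<close>): its first term is nonnegative, its last term is constant there, and the
  remaining term is controlled by the \<open>L\<^sup>2\<close> norm, because its kernel satisfies \<open>0 \<le> j \<le> 1\<close> and
  only the bounded set \<open>\<Omega> \<times> \<Omega>\<close> contributes. Hence the infimum that defines the
  first eigenvalue \<open>\<lambda>\<^sub>1\<close> is a true lower bound, and \<open>E_L u u \<ge> \<lambda>\<^sub>1\<close> for every \<open>u\<close> in
  \<open>P_set \<Omega>\<close> (\<open>first_eigenvalue_le\<close>).

  For \<open>r \<ge> 0\<close>, subtracting \<open>r \<integral> (u\<^sup>+)\<^sup>2 \<le> r \<integral> u\<^sup>2 = r\<close> costs at most \<open>r\<close>, so \<open>E_fun \<Omega> r \<ge> \<lambda>\<^sub>1 - r\<close>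
  on \<open>P_set \<Omega>\<close>. Equality holds at the positive first eigenfunction \<open>\<phi>\<close>, since \<open>\<phi>\<^sup>+ = \<phi>\<close> and
  \<open>\<phi>\<^sup>- = 0\<close> almost everywhere. For the same reason, replacing \<open>\<phi>\<close> by \<open>\<phi>\<^sup>+\<close> in the eigenvalue equation
  gives both the Euler-Lagrange equation of the constrained functional, with multiplier
  \<open>\<lambda>\<^sub>1 - r\<close>, and the Fucik equation with coefficients \<open>\<lambda>\<^sub>1\<close> and \<open>\<lambda>\<^sub>1 - r\<close>.
\<close>

lemma j_kernel_bounds:
  fixes z :: "'a::euclidean_space"
  shows "0 \<le> j_kernel z" "j_kernel z \<le> 1"
  by (auto simp: j_kernel_def indicator_def divide_le_eq_1)

lemma k_kernel_nonneg: "0 \<le> k_kernel z"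
  by (simp add: k_kernel_def)

lemma c_const_nonneg: "0 < N \<Longrightarrow> 0 \<le> c_const N"
  by (simp add: c_const_def less_imp_le Gamma_real_pos)

lemma H_spaceD:
  assumes "u \<in> H_space \<Omega>"
  shows "u \<in> borel_measurable borel" "\<And>x. x \<notin> \<Omega> \<Longrightarrow> u x = 0"
    "integrable lborel (\<lambda>x. (u x)\<^sup>2)"
proof -
  show "u \<in> borel_measurable borel" and zero: "\<And>x. x \<notin> \<Omega> \<Longrightarrow> u x = 0"
    using assms by (auto simp: H_space_def)
  have "(\<lambda>x. indicat_real \<Omega> x *\<^sub>R (u x)\<^sup>2) = (\<lambda>x. (u x)\<^sup>2)"
    using zero by (intro ext) (auto simp: indicator_def)
  then show "integrable lborel (\<lambda>x. (u x)\<^sup>2)"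
    using assms by (simp add: H_space_def set_integrable_def)
qed

lemma set_integral_eq_integral_if_vanishing:
  fixes f :: "'a::euclidean_space \<Rightarrow> real"
  assumes "\<And>x. x \<notin> \<Omega> \<Longrightarrow> f x = 0"
  shows "(LINT x:\<Omega>|lborel. f x) = (LINT x|lborel. f x)"
  unfolding set_lebesgue_integral_def
  by (intro Bochner_Integration.integral_cong refl) (auto simp: indicator_def assms)

lemma I_fun_eq_integral:
  "u \<in> H_space \<Omega> \<Longrightarrow> I_fun \<Omega> u = (LINT x|lborel. (u x)\<^sup>2)"
  unfolding I_fun_def
  by (rule set_integral_eq_integral_if_vanishing) (simp add: H_spaceD(2))

lemma P_set_iff_L2_norm: "u \<in> P_set \<Omega> \<longleftrightarrow> u \<in> H_space \<Omega> \<and> L2_norm \<Omega> u = 1"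
  by (simp add: P_set_def L2_norm_def I_fun_def)

lemma E_form_nonneg: "0 \<le> E_form u (u :: 'a::euclidean_space \<Rightarrow> real)"
proof -
  have "0 \<le> (LINT (x, y)|(lborel \<Otimes>\<^sub>M lborel). (u x - u y) * (u x - u y) * k_kernel (x - y))"
    by (rule Bochner_Integration.integral_nonneg) (auto simp: k_kernel_nonneg)
  then show ?thesis
    by (simp add: E_form_def c_const_nonneg)
qed

lemma integrable_integral_pair_product:
  fixes f g :: "'a::euclidean_space \<Rightarrow> real"
  assumes f: "integrable lborel f" and g: "integrable lborel g"
  shows "integrable (lborel \<Otimes>\<^sub>M lborel) (\<lambda>(x, y). f x * g y)"
    and "(LINT (x, y)|(lborel \<Otimes>\<^sub>M lborel). f x * g y)
           = (LINT x|lborel. f x) * (LINT x|lborel. g x)"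
proof -
  have [measurable]: "f \<in> borel_measurable borel" "g \<in> borel_measurable borel"
    using f g by auto
  show int: "integrable (lborel \<Otimes>\<^sub>M lborel) (\<lambda>(x, y). f x * g y)"
    by (rule lborel_pair.Fubini_integrable) (use f g in \<open>auto simp: abs_mult\<close>)
  show "(LINT (x, y)|(lborel \<Otimes>\<^sub>M lborel). f x * g y)
      = (LINT x|lborel. f x) * (LINT x|lborel. g x)"
    using lborel_pair.integral_fst'[OF int] by simp
qed

text \<open>
  Since \<open>0 \<le> j \<le> 1\<close>, the integrand is at most \<open>(u(x)\<^sup>2 + u(y)\<^sup>2) / 2\<close> on \<open>\<Omega> \<times> \<Omega>\<close> and vanishes
  elsewhere; each of the two summands integrates to half of the right-hand side.
\<close>

lemma j_term_le:
  fixes u :: "'a::euclidean_space \<Rightarrow> real"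
  assumes "open \<Omega>" "bounded \<Omega>" "u \<in> H_space \<Omega>"
  shows "(LINT (x, y)|(lborel \<Otimes>\<^sub>M lborel). u x * u y * j_kernel (x - y))
           \<le> measure lborel \<Omega> * I_fun \<Omega> u"
proof -
  note u = H_spaceD[OF assms(3)]
  define g where "g = (\<lambda>x. (u x)\<^sup>2)"
  define h where "h = indicat_real \<Omega>"
  have g: "integrable lborel g"
    unfolding g_def by (rule u(3))
  have h: "integrable lborel h"
    unfolding h_def using assms(1,2)
    by (intro integrable_real_indicator)
      (auto simp flip: infinity_ennreal_def intro: emeasure_bounded_finite)
  have int_h: "(LINT x|lborel. h x) = measure lborel \<Omega>"
    by (simp add: h_def)
  have int_g: "(LINT x|lborel. g x) = I_fun \<Omega> u"
    using I_fun_eq_integral[OF assms(3)] by (simp add: g_def)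
  note gh = integrable_integral_pair_product[OF g h]
    and hg = integrable_integral_pair_product[OF h g]
  have "(LINT (x, y)|(lborel \<Otimes>\<^sub>M lborel). u x * u y * j_kernel (x - y))
      \<le> (LINT (x, y)|(lborel \<Otimes>\<^sub>M lborel). (g x * h y + h x * g y) / 2)"
  proof (rule integral_mono')
    show "integrable (lborel \<Otimes>\<^sub>M lborel) (\<lambda>(x, y). (g x * h y + h x * g y) / 2)"
      using gh(1) hg(1) by (simp add: case_prod_unfold)
  next
    fix p :: "'a \<times> 'a"
    obtain x y where p: "p = (x, y)"
      by fastforce
    have "u x * u y * j_kernel (x - y) \<le> \<bar>u x * u y\<bar> * 1"
      using j_kernel_bounds[of "x - y"] by (intro mult_mono) auto
    also have "\<dots> \<le> ((u x)\<^sup>2 + (u y)\<^sup>2) / 2" if "x \<in> \<Omega>" "y \<in> \<Omega>"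
      using sum_squares_bound[of "\<bar>u x\<bar>" "\<bar>u y\<bar>"] by (simp add: abs_mult)
    finally show "(case p of (x, y) \<Rightarrow> u x * u y * j_kernel (x - y))
        \<le> (case p of (x, y) \<Rightarrow> (g x * h y + h x * g y) / 2)"
      using u(2) by (cases "x \<in> \<Omega>"; cases "y \<in> \<Omega>") (auto simp: p g_def h_def)
    show "0 \<le> (case p of (x, y) \<Rightarrow> (g x * h y + h x * g y) / 2)"
      by (simp add: p g_def h_def)
  qed
  also have "\<dots> = measure lborel \<Omega> * I_fun \<Omega> u"
    using gh hg int_g int_h by (simp add: case_prod_unfold)
  finally show ?thesis .
qed

lemma E_L_bounded_below:
  fixes u :: "'a::euclidean_space \<Rightarrow> real"
  assumes "open \<Omega>" "bounded \<Omega>" "u \<in> P_set \<Omega>"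
  shows "rho_const DIM('a) - c_const DIM('a) * measure lborel \<Omega> \<le> E_L u u"
proof -
  have u: "u \<in> H_space \<Omega>" "I_fun \<Omega> u = 1"
    using assms(3) by (auto simp: P_set_def)
  have "(LINT x|lborel. u x * u x) = 1"
    using I_fun_eq_integral[OF u(1)] u(2) by (simp add: power2_eq_square)
  moreover have "c_const DIM('a) *
      (LINT (x, y)|(lborel \<Otimes>\<^sub>M lborel). u x * u y * j_kernel (x - y))
      \<le> c_const DIM('a) * measure lborel \<Omega>"
    using j_term_le[OF assms(1,2) u(1)] u(2) by (intro mult_left_mono) (auto simp: c_const_nonneg)
  ultimately show ?thesis
    using E_form_nonneg[of u] by (simp add: E_L_def)
qed

lemma first_eigenvalue_le:
  assumes "open \<Omega>" "bounded \<Omega>" "u \<in> P_set \<Omega>"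
  shows "first_eigenvalue \<Omega> \<le> E_L u u"
  unfolding first_eigenvalue_def
proof (rule cInf_lower)
  show "E_L u u \<in> {E_L u u |u. u \<in> H_space \<Omega> \<and> L2_norm \<Omega> u = 1}"
    using assms(3) by (auto simp: P_set_iff_L2_norm)
  show "bdd_below {E_L u u |u. u \<in> H_space \<Omega> \<and> L2_norm \<Omega> u = 1}"
    using E_L_bounded_below[OF assms(1,2)] by (auto simp: P_set_iff_L2_norm intro!: bdd_belowI)
qed

lemma integral_pos_part_le:
  assumes "u \<in> H_space \<Omega>"
  shows "(LINT x:\<Omega>|lborel. (pos_part u x)\<^sup>2) \<le> I_fun \<Omega> u"
proof -
  have "(LINT x:\<Omega>|lborel. (pos_part u x)\<^sup>2) = (LINT x|lborel. (pos_part u x)\<^sup>2)"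
    by (rule set_integral_eq_integral_if_vanishing) (simp add: pos_part_def H_spaceD(2)[OF assms])
  also have "\<dots> \<le> (LINT x|lborel. (u x)\<^sup>2)"
    by (rule integral_mono'[OF H_spaceD(3)[OF assms]]) (auto simp: pos_part_def max_def)
  finally show ?thesis
    by (simp add: I_fun_eq_integral[OF assms])
qed

text \<open>
  For a nonnegative function the positive and negative parts disappear from all integrals; this
  is what makes the piecewise linear equations reduce to the linear eigenvalue equation.
\<close>

lemma set_integral_parts_of_nonneg:
  fixes u v :: "'a::euclidean_space \<Rightarrow> real"
  assumes "open \<Omega>" and [measurable]: "u \<in> borel_measurable borel" "v \<in> borel_measurable borel"
    and nonneg: "AE x in lborel. x \<in> \<Omega> \<longrightarrow> 0 \<le> u x"
  shows "(LINT x:\<Omega>|lborel. (\<alpha> * pos_part u x - \<beta> * neg_part u x) * v x)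
           = \<alpha> * (LINT x:\<Omega>|lborel. u x * v x)"
    and "(LINT x:\<Omega>|lborel. pos_part u x * v x) = (LINT x:\<Omega>|lborel. u x * v x)"
    and "(LINT x:\<Omega>|lborel. (pos_part u x)\<^sup>2) = I_fun \<Omega> u"
proof -
  have [measurable]: "\<Omega> \<in> sets borel"
    using assms(1) by simp
  have [measurable]: "pos_part u \<in> borel_measurable borel" "neg_part u \<in> borel_measurable borel"
    unfolding pos_part_def[abs_def] neg_part_def[abs_def] by measurable
  have parts: "AE x in lborel. x \<in> \<Omega> \<longrightarrow> pos_part u x = u x \<and> neg_part u x = 0"
    using nonneg by eventually_elim (auto simp: pos_part_def neg_part_def)
  have "(LINT x:\<Omega>|lborel. (\<alpha> * pos_part u x - \<beta> * neg_part u x) * v x)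
      = (LINT x:\<Omega>|lborel. \<alpha> * (u x * v x))"
    unfolding set_lebesgue_integral_def
    by (rule integral_cong_AE, measurable, use parts in eventually_elim)
      (auto simp: indicator_def)
  then show "(LINT x:\<Omega>|lborel. (\<alpha> * pos_part u x - \<beta> * neg_part u x) * v x)
      = \<alpha> * (LINT x:\<Omega>|lborel. u x * v x)"
    by simp
  show "(LINT x:\<Omega>|lborel. pos_part u x * v x) = (LINT x:\<Omega>|lborel. u x * v x)"
    unfolding set_lebesgue_integral_def
    by (rule integral_cong_AE, measurable, use parts in eventually_elim)
      (auto simp: indicator_def)
  show "(LINT x:\<Omega>|lborel. (pos_part u x)\<^sup>2) = I_fun \<Omega> u"
    unfolding set_lebesgue_integral_def I_fun_def
    by (rule integral_cong_AE, measurable, use parts in eventually_elim)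
      (auto simp: indicator_def)
qed

theorem proposition3p2:
  fixes \<Omega> :: "'a::euclidean_space set" and \<phi>\<^sub>1 :: "'a \<Rightarrow> real" and r :: real
  assumes "open \<Omega>" and "connected \<Omega>" and "\<Omega> \<noteq> {}" and "bounded \<Omega>"
    and "C11_boundary \<Omega>"
    and "is_first_eigenfunction \<Omega> \<phi>\<^sub>1"
    and "r \<ge> 0"
  shows "is_critical_point \<Omega> r \<phi>\<^sub>1
    \<and> (\<forall>u\<in>P_set \<Omega>. E_fun \<Omega> r \<phi>\<^sub>1 \<le> E_fun \<Omega> r u)
    \<and> E_fun \<Omega> r \<phi>\<^sub>1 = first_eigenvalue \<Omega> - r
    \<and> (first_eigenvalue \<Omega>, first_eigenvalue \<Omega> - r) \<in> Fucik_spectrum \<Omega>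
    \<and> (first_eigenvalue \<Omega>, first_eigenvalue \<Omega> - r) \<in> {first_eigenvalue \<Omega>} \<times> UNIV"
proof -
  let ?\<mu> = "first_eigenvalue \<Omega>"
  have \<phi>: "\<phi>\<^sub>1 \<in> H_space \<Omega>" "\<phi>\<^sub>1 \<in> P_set \<Omega>" "I_fun \<Omega> \<phi>\<^sub>1 = 1"
    and eigen: "\<And>v. v \<in> H_space \<Omega> \<Longrightarrow> E_L \<phi>\<^sub>1 v = ?\<mu> * (LINT x:\<Omega>|lborel. \<phi>\<^sub>1 x * v x)"
    using assms(6) by (auto simp: is_first_eigenfunction_def P_set_def L2_norm_def I_fun_def)
  have "AE x in lborel. x \<in> \<Omega> \<longrightarrow> 0 < \<phi>\<^sub>1 x"
    using assms(6) by (simp add: is_first_eigenfunction_def)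
  then have nonneg: "AE x in lborel. x \<in> \<Omega> \<longrightarrow> 0 \<le> \<phi>\<^sub>1 x"
    by eventually_elim auto
  note parts = set_integral_parts_of_nonneg[OF assms(1) H_spaceD(1)[OF \<phi>(1)] _ nonneg]

  have "E_L \<phi>\<^sub>1 v - r * (LINT x:\<Omega>|lborel. pos_part \<phi>\<^sub>1 x * v x)
      = (?\<mu> - r) * (LINT x:\<Omega>|lborel. \<phi>\<^sub>1 x * v x)" if "v \<in> H_space \<Omega>" for v
    using eigen[OF that] parts(2)[OF H_spaceD(1)[OF that]] by (simp add: left_diff_distrib)
  then have critical: "is_critical_point \<Omega> r \<phi>\<^sub>1"
    using \<phi>(2) by (auto simp: is_critical_point_def)

  have "E_L \<phi>\<^sub>1 \<phi>\<^sub>1 = ?\<mu>"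
    using eigen[OF \<phi>(1)] \<phi>(3) by (simp add: I_fun_def power2_eq_square)
  then have energy: "E_fun \<Omega> r \<phi>\<^sub>1 = ?\<mu> - r"
    using parts(3)[OF H_spaceD(1)[OF \<phi>(1)]] \<phi>(3) by (simp add: E_fun_def)

  have minimum: "E_fun \<Omega> r \<phi>\<^sub>1 \<le> E_fun \<Omega> r u" if "u \<in> P_set \<Omega>" for u
  proof -
    have "r * (LINT x:\<Omega>|lborel. (pos_part u x)\<^sup>2) \<le> r * 1"
      using integral_pos_part_le[of u \<Omega>] that assms(7)
      by (intro mult_left_mono) (auto simp: P_set_def)
    then show ?thesis
      using first_eigenvalue_le[OF assms(1,4) that]
      unfolding energy by (simp add: E_fun_def)
  qed

  have fucik: "E_L \<phi>\<^sub>1 v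
      = (LINT x:\<Omega>|lborel. (?\<mu> * pos_part \<phi>\<^sub>1 x - (?\<mu> - r) * neg_part \<phi>\<^sub>1 x) * v x)"
    if "v \<in> H_space \<Omega>" for v
    using eigen[OF that] parts(1)[OF H_spaceD(1)[OF that]] by simp
  have "\<not> (AE x in lborel. \<phi>\<^sub>1 x = 0)"
  proof
    assume "AE x in lborel. \<phi>\<^sub>1 x = 0"
    then have "(LINT x|lborel. (\<phi>\<^sub>1 x)\<^sup>2) = 0"
      by (intro integral_eq_zero_AE) auto
    then show False
      using I_fun_eq_integral[OF \<phi>(1)] \<phi>(3) by simp
  qed
  then have "(?\<mu>, ?\<mu> - r) \<in> Fucik_spectrum \<Omega>"
    using \<phi>(1) fucik unfolding Fucik_spectrum_def by blast
  then show ?thesis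
    using critical minimum energy by auto
qed

end
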